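(* Let $\mu,p\in\mathbb{C}$ be such that neither $\mu+p$ nor $\mu-p$ is a negative odd integer, $\operatorname{Re}\mu>-1$, and $$\left|\frac{(\mu+1)^2-p^2}{2}\right|\sqrt{3}<\frac{\operatorname{Re}\mu}{2\sqrt{2}}+\frac{3}{8\sqrt{2}}.$$ Let $f_{\mu,p}(z)=\int_0^z\frac{h_{\mu,p}(t)}{t}\,dt$, where $h_{\mu,p}$ is the normalized Lommel function. Then $$f_{\mu,p}'(z)=\frac{h_{\mu,p}(z)}{z}\prec\sqrt{1+z}\quad\text{in }\mathbb{D}.$$
   Context: $\mathbb{D}=\{z\in\mathbb{C}:|z|<1\}$. For analytic functions $f,g$ on $\mathbb{D}$, $f\prec g$ ($f$ is subordinate to $g$) means that there is an analytic $w:\mathbb{D}\to\mathbb{D}$ with $w(0)=0$ and $f=g\circ w$. $\sqrt{1+z}$ denotes the principal branch (value $1$ at $z=0$). For $\mu\pm p$ not negative odd integers, the normalized Lommel function of the first kind is $$h_{\mu,p}(z)=(\mu-p+1)(\mu+p+1)z^{\frac{1-\mu}{2}}s_{\mu,p}(\sqrt z)=z+\sum_{n=1}^{\infty}\frac{(-1/4)^n}{(K)_n(F)_n}z^{n+1},\qquad K=\frac{\mu-p+3}{2},\ F=\frac{\mu+p+3}{2},$$ where $s_{\mu,p}$ is the Lommel function of the first kind and $(\lambda)_n=\lambda(\lambda+1)\cdots(\lambda+n-1)$, $(\lambda)_0=1$. The power series may be taken as the definition of $h_{\mu,p}$. *)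

theory Defs
  imports "HOL-Complex_Analysis.Complex_Analysis"
begin

definition subordinate :: "(complex \<Rightarrow> complex) \<Rightarrow> (complex \<Rightarrow> complex) \<Rightarrow> bool"
    (infix "\<prec>\<^sub>D" 50) where
  "f \<prec>\<^sub>D g \<longleftrightarrow>
     f holomorphic_on ball 0 1 \<and> g holomorphic_on ball 0 1 \<and>
     (\<exists>w. w holomorphic_on ball 0 1 \<and> w \<in> ball 0 1 \<rightarrow> ball 0 1 \<and> w 0 = 0 \<and>
          (\<forall>z\<in>ball 0 1. f z = g (w z)))"

text \<open>The normalized Lommel function of the first kind, given by its power series; the
  summation index is shifted by one, so that the series starts at the term in \<open>z\<^sup>2\<close>.\<close>

definition lommel_h :: "complex \<Rightarrow> complex \<Rightarrow> complex \<Rightarrow> complex" where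
  "lommel_h \<mu> p z =
     z + (\<Sum>n. (-1/4) ^ Suc n /
              (pochhammer ((\<mu> - p + 3) / 2) (Suc n) * pochhammer ((\<mu> + p + 3) / 2) (Suc n))
              * z ^ (Suc n + 1))"

text \<open>The integrand has a removable singularity at \<open>0\<close>; the value \<open>0\<close> that HOL gives to
  \<open>0 / 0\<close> at this endpoint does not affect the integral.\<close>

definition lommel_f :: "complex \<Rightarrow> complex \<Rightarrow> complex \<Rightarrow> complex" where
  "lommel_f \<mu> p z = contour_integral (linepath 0 z) (\<lambda>t. lommel_h \<mu> p t / t)"

end

theory Submission
  imports Defs
begin

text \<open>
  With \<open>\<theta> = z d/dz\<close>, the function \<open>g(z) = h(z)/z\<close> satisfies
  \<open>\<theta>\<^sup>2 g + (\<mu> + 1) \<theta> g + A (g - 1) + z g / 4 = 0\<close>, where \<open>4 A = (\<mu> + 1)\<^sup>2 - p\<^sup>2\<close>.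
  Let \<open>w = g\<^sup>2 - 1\<close>. If \<open>|w| < 1\<close> fails in the disc, take a point \<open>\<zeta>\<close> of least modulus with
  \<open>|w(\<zeta>)| = 1\<close>. By the lemma of Jack, Miller and Mocanu, \<open>\<theta> w = m w\<close> and
  \<open>Re (\<theta>\<^sup>2 w / w) \<ge> m\<^sup>2\<close> at \<open>\<zeta>\<close> with \<open>m \<ge> 1\<close>. Multiplying the differential equation
  by \<open>2 g / w\<close> and using \<open>Re (w / (1 + w)) = 1/2\<close> on the unit circle gives
  \<open>3/4 + Re (\<mu> + 1) \<le> 2 |g| (|A| |g - 1| + |g| / 4)\<close>, which the hypothesis excludes since
  \<open>|g|\<^sup>2 \<le> 2\<close>. Finally, \<open>|g\<^sup>2 - 1| < 1\<close> keeps \<open>g\<close> off the imaginary axis, so \<open>g\<close> is the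
  principal root of \<open>1 + w\<close>.
\<close>

section \<open>The lemma of Jack, Miller and Mocanu\<close>

text \<open>If \<open>c\<close> were positive, \<open>p'\<close> would be positive just to the right
  of its zero \<open>a\<close>, so \<open>p\<close> would rise above \<open>p a\<close>.\<close>

lemma second_deriv_nonpos_at_max:
  fixes p p' :: "real \<Rightarrow> real"
  assumes p: "\<And>x. (p has_real_derivative p' x) (at x)"
    and p': "(p' has_real_derivative c) (at a)"
    and max: "\<And>x. p x \<le> p a"
  shows "p' a = 0" "c \<le> 0"
proof -
  show z: "p' a = 0"
    using DERIV_local_max[OF p, of 1 a] max by auto
  show "c \<le> 0"
  proof (rule ccontr)
    assume "\<not> c \<le> 0"
    then obtain d where d: "d > 0" "\<And>h. h > 0 \<Longrightarrow> h < d \<Longrightarrow> 0 < p' (a + h)"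
      using DERIV_pos_inc_right[OF p'] z by force
    have "p a < p (a + d / 2)"
    proof (rule DERIV_pos_imp_increasing_open[where f = p])
      show "\<exists>y. (p has_real_derivative y) (at x) \<and> 0 < y" if "a < x" "x < a + d / 2" for x
        using p[of x] d(2)[of "x - a"] d(1) that by auto
    next
      show "continuous_on {a..a + d / 2} p"
        using p by (meson DERIV_isCont continuous_at_imp_continuous_on)
    qed (use d in auto)
    with max[of "a + d / 2"] show False by simp
  qed
qed

text \<open>Along a circle about the origin, d/dt acts as \<open>\<i>\<close> times the Euler
  operator z d/dz, so two derivatives in t amount to minus its square.\<close>

lemma has_vector_derivative_circle:
  assumes "(f has_field_derivative d) (at (z * cis t))"
  shows "((\<lambda>t. f (z * cis t)) has_vector_derivative \<i> * (z * cis t * d)) (at t)"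
proof -
  have "((\<lambda>t. z * cis t) has_vector_derivative \<i> * (z * cis t)) (at t)"
    by (auto intro!: derivative_eq_intros simp: has_vector_derivative_def fun_eq_iff scaleR_conv_of_real)
  from field_vector_diff_chain_at[OF this assms] show ?thesis
    by (simp add: o_def mult_ac)
qed

text \<open>Maximality of the modulus along the circle through \<zeta> makes m real and gives the
  second-order bound; the Schwarz lemma in the radial direction gives \<open>m \<ge> 1\<close>. Here
  \<open>\<zeta> * d\<close> is the square of the Euler operator applied to \<open>w\<close>, at
  \<zeta>.\<close>

lemma Jack_Miller_Mocanu:
  fixes w w' :: "complex \<Rightarrow> complex"
  assumes w': "\<And>z. norm z < R \<Longrightarrow> (w has_field_derivative w' z) (at z)"
    and w'': "((\<lambda>z. z * w' z) has_field_derivative d) (at \<zeta>)"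
    and w0: "w 0 = 0" and \<zeta>: "norm \<zeta> < R"
    and less: "\<And>z. norm z < norm \<zeta> \<Longrightarrow> norm (w z) < norm (w \<zeta>)"
    and nz: "w \<zeta> \<noteq> 0"
  obtains m :: real where "m \<ge> 1" "\<zeta> * w' \<zeta> = of_real m * w \<zeta>" "m\<^sup>2 \<le> Re (\<zeta> * d / w \<zeta>)"
proof -
  have \<zeta>0: "\<zeta> \<noteq> 0" using w0 nz by auto
  have contw: "continuous_on (ball 0 R) w"
    using w' by (intro continuous_at_imp_continuous_on ballI) (auto intro: DERIV_isCont)
  have le: "norm (w z) \<le> norm (w \<zeta>)" if "norm z \<le> norm \<zeta>" for z
  proof (rule continuous_le_on_closure[where S = "ball 0 (norm \<zeta>)" and f = "\<lambda>z. norm (w z)"])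
    show "continuous_on (closure (ball 0 (cmod \<zeta>))) (\<lambda>z. cmod (w z))"
      using \<zeta> \<zeta>0 by (intro continuous_on_norm continuous_on_subset[OF contw]) auto
  qed (use that less \<zeta>0 in \<open>auto simp: less_imp_le\<close>)
  define u where "u = (\<lambda>z. w z / w \<zeta>)"
  define D where "D = (\<lambda>z. z * w' z / w \<zeta>)"
  define e where "e = \<zeta> * d / w \<zeta>"
  have u: "(u has_field_derivative w' z / w \<zeta>) (at z)" if "norm z < R" for z
    unfolding u_def using w'[OF that] by (rule DERIV_cdivide)
  have D: "(D has_field_derivative d / w \<zeta>) (at \<zeta>)"
    unfolding D_def using w'' by (rule DERIV_cdivide)

  text \<open>The squared modulus of \<open>U\<close> is maximal at \<open>0\<close>: its first two derivatives there show that
    \<open>D \<zeta>\<close> is real and bound \<open>Re e\<close>.\<close>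
  define U where "U = (\<lambda>t. u (\<zeta> * cis t))"
  define V where "V = (\<lambda>t. \<i> * D (\<zeta> * cis t))"
  have U: "(U has_vector_derivative V t) (at t)" for t
    using has_vector_derivative_circle[OF u, of \<zeta> t] \<zeta>
    by (simp add: U_def V_def D_def norm_mult)
  have "((\<lambda>t. D (\<zeta> * cis t)) has_vector_derivative \<i> * (\<zeta> * cis 0 * (d / w \<zeta>))) (at 0)"
    by (rule has_vector_derivative_circle) (use D in simp)
  hence V: "(V has_vector_derivative - e) (at 0)"
    unfolding V_def e_def by (auto dest: has_vector_derivative_mult_right[where a = \<i>])
  have [simp]: "U 0 = 1" using nz by (simp add: U_def u_def)
  define p where "p = (\<lambda>t. (Re (U t))\<^sup>2 + (Im (U t))\<^sup>2)"
  define p' where "p' = (\<lambda>t. 2 * (Re (U t) * Re (V t) + Im (U t) * Im (V t)))"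
  have p: "(p has_real_derivative p' t) (at t)" for t
    unfolding p_def p'_def by (auto intro!: derivative_eq_intros U)
  \<comment> \<open>Since \<open>U 0 = 1\<close> and the second derivative of \<open>U\<close> at 0
    is \<open>- e\<close>, the term Re (cnj U U'') becomes \<open>- Re e\<close>.\<close>
  have p': "(p' has_real_derivative 2 * ((Re (V 0))\<^sup>2 + (Im (V 0))\<^sup>2 - Re e)) (at 0)"
    unfolding p'_def by (auto intro!: derivative_eq_intros U V simp: power2_eq_square)
  have pmax: "p t \<le> p 0" for t
  proof -
    have "norm (U t) \<le> 1"
      using le[of "\<zeta> * cis t"] nz by (simp add: U_def u_def norm_mult norm_divide)
    then show ?thesis
      unfolding p_def by (simp flip: cmod_power2 add: power_le_one)
  qed
  from second_deriv_nonpos_at_max[OF p p' pmax]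
  have ReV: "Re (V 0) = 0" and Ree: "(Im (V 0))\<^sup>2 \<le> Re e"
    by (auto simp: p'_def)
  define m where "m = Re (D \<zeta>)"
  have Dm: "D \<zeta> = of_real m" and Vm: "Im (V 0) = m"
    using ReV by (auto simp: V_def m_def complex_eq_iff)

  \<comment> \<open>Rescaling sends the disc of radius \<open>norm \<zeta>\<close> to the unit disc
    and \<zeta> to 1, where \<open>f\<close> has the value 1.\<close>
  define f where "f = (\<lambda>z. u (\<zeta> * z))"
  have schwarz: "norm (f z) \<le> norm z" if "norm z < 1" for z
  proof (rule Schwarz_Lemma(1))
    have "(f has_field_derivative w' (\<zeta> * z) / w \<zeta> * \<zeta>) (at z)" if "norm z < 1" for z
    proof -
      have "norm (\<zeta> * z) < R"
        using that \<zeta> mult_left_mono[of "norm z" 1 "norm \<zeta>"] by (simp add: norm_mult)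
      from DERIV_chain2[where f = u and g = "\<lambda>z. \<zeta> * z", OF u[OF this], of \<zeta> UNIV] show ?thesis
        unfolding f_def by (auto intro!: derivative_eq_intros)
    qed
    then show "f holomorphic_on ball 0 1"
      by (metis holomorphic_on_open open_ball mem_ball_0)
    show "norm (f z) < 1" if "norm z < 1" for z
      using less[of "\<zeta> * z"] that \<zeta>0 nz by (simp add: f_def u_def norm_mult norm_divide)
  qed (use w0 that in \<open>auto simp: f_def u_def\<close>)
  have "((\<lambda>s. f (of_real s)) has_vector_derivative D \<zeta>) (at (1::real))"
  proof -
    have "((\<lambda>s. \<zeta> * of_real s) has_vector_derivative \<zeta>) (at (1::real))"
      by (auto intro!: derivative_eq_intros simp: has_vector_derivative_def scaleR_conv_of_real)
    from field_vector_diff_chain_at[OF this, of u "w' \<zeta> / w \<zeta>"] u[OF \<zeta>] show ?thesis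
      by (simp add: f_def o_def D_def)
  qed
  from DERIV_diff[OF DERIV_ident has_field_derivative_Re[OF this]]
  have q: "((\<lambda>s. s - Re (f (of_real s))) has_real_derivative 1 - m) (at 1)"
    by (simp add: m_def)
  \<comment> \<open>If m < 1, then s - Re (f s), which is 0 at s = 1, would be negative just to the
    left of 1, against the Schwarz bound.\<close>
  have "m \<ge> 1"
  proof (rule ccontr)
    assume "\<not> m \<ge> 1"
    then obtain r where r: "r > 0" and
      *: "\<And>h. 0 < h \<Longrightarrow> h < r \<Longrightarrow> 1 - h - Re (f (of_real (1 - h))) < 1 - Re (f (of_real 1))"
      using DERIV_pos_inc_left[OF q] by force
    define h where "h = min (r / 2) (1 / 2)"
    have h: "0 < h" "h < r" "h < 1" using r by (auto simp: h_def)
    have "Re (f (of_real (1 - h))) \<le> norm (f (of_real (1 - h)))" by (rule complex_Re_le_cmod)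
    also have "\<dots> \<le> 1 - h" using schwarz[of "of_real (1 - h)"] h by (simp only: norm_of_real) simp
    finally show False using *[OF h(1,2)] nz by (simp add: f_def u_def)
  qed
  moreover have "\<zeta> * w' \<zeta> = of_real m * w \<zeta>"
    using Dm nz by (simp add: D_def field_simps)
  moreover have "m\<^sup>2 \<le> Re (\<zeta> * d / w \<zeta>)"
    using Ree Vm by (simp add: e_def)
  ultimately show ?thesis using that by blast
qed

section \<open>From the differential equation to the lemniscate and its principal root\<close>

text \<open>On the unit circle Re (w cnj (1 + w)) = 1 + Re w, which is half of the squared modulus
  of 1 + w.\<close>

lemma Re_div_one_plus:
  fixes w :: complex
  assumes "norm w = 1" "w \<noteq> -1"
  shows "Re (w / (1 + w)) = 1 / 2"
proof -
  have n: "(Re w)\<^sup>2 + (Im w)\<^sup>2 = 1"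
    using assms(1) by (simp flip: cmod_power2)
  have "(1 + Re w)\<^sup>2 + (Im w)\<^sup>2 = 2 * (1 + Re w)"
    using n by (simp add: power2_eq_square algebra_simps)
  moreover have "Re w * (1 + Re w) + Im w * Im w = 1 + Re w"
    using n by (simp add: power2_eq_square algebra_simps)
  moreover have "1 + Re w \<noteq> 0"
  proof
    assume "1 + Re w = 0"
    hence "Re w = -1" by simp
    with n have "w = -1" by (simp add: complex_eq_iff)
    with assms(2) show False ..
  qed
  ultimately show ?thesis
    by (simp add: Re_divide field_simps)
qed

text \<open>The constant \<open>7\<close> bounds \<open>2 |g| |g - 1|\<close> when \<open>|g|\<^sup>2 \<le> 2\<close>.\<close>

lemma lemniscate_bound_of_ode:
  fixes g g' t' :: "complex \<Rightarrow> complex"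
  assumes g: "\<And>z. norm z < 1 \<Longrightarrow> (g has_field_derivative g' z) (at z)"
    and t: "\<And>z. norm z < 1 \<Longrightarrow> ((\<lambda>z. z * g' z) has_field_derivative t' z) (at z)"
    and ode: "\<And>z. norm z < 1 \<Longrightarrow> z * t' z + a * (z * g' z) + A * (g z - 1) + z * g z / 4 = 0"
    and g0: "g 0 = 1"
    and bound: "7 * norm A < Re a - 1 / 4"
    and z: "norm z < 1"
  shows "norm ((g z)\<^sup>2 - 1) < 1"
proof (rule ccontr)
  assume "\<not> norm ((g z)\<^sup>2 - 1) < 1"
  define w where "w = (\<lambda>z. (g z)\<^sup>2 - 1)"
  \<comment> \<open>The inequality \<open>1 \<le>\<close> puts \<open>z\<close> itself into
    \<open>S\<close>; equality at the minimizer follows by continuity from inside.\<close>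
  define S where "S = {u \<in> cball 0 (norm z). 1 \<le> norm (w u)}"
  have w: "(w has_field_derivative 2 * g u * g' u) (at u)" if "norm u < 1" for u
    unfolding w_def using g[OF that] by (auto intro!: derivative_eq_intros)
  have cont: "continuous_on (cball 0 (norm z)) w"
    using w z by (intro continuous_at_imp_continuous_on ballI) (auto intro: DERIV_isCont[OF w])
  have "bounded S"
    by (rule bounded_subset[OF bounded_cball[of 0 "norm z"]]) (auto simp: S_def)
  moreover have "closed S"
    unfolding S_def
    using continuous_closed_preimage[OF continuous_on_norm[OF cont] closed_cball closed_atLeast, of 1]
    by (auto simp: vimage_def Int_def)
  moreover have "z \<in> S"
    using \<open>\<not> _\<close> by (auto simp: S_def w_def)
  ultimately obtain \<zeta> where \<zeta>: "\<zeta> \<in> S" "\<And>u. u \<in> S \<Longrightarrow> norm \<zeta> \<le> norm u"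
    using continuous_attains_inf[of S norm]
    by (auto simp: compact_eq_bounded_closed intro: continuous_intros)
  have \<zeta>1: "norm \<zeta> < 1" and \<zeta>z: "norm \<zeta> \<le> norm z" and w\<zeta>: "1 \<le> norm (w \<zeta>)"
    using \<zeta>(1) z by (auto simp: S_def)
  have inside: "norm (w u) < 1" if "norm u < norm \<zeta>" for u
    using \<zeta>(2)[of u] that \<zeta>z by (force simp: S_def)
  have w0: "w 0 = 0" by (simp add: w_def g0)
  have "\<zeta> \<noteq> 0" using w0 w\<zeta> by auto
  have "norm (w \<zeta>) \<le> 1"
  proof (rule continuous_on_closure_norm_le[where s = "ball 0 (norm \<zeta>)" and f = w])
    show "continuous_on (closure (ball 0 (norm \<zeta>))) w"
      using \<zeta>z \<open>\<zeta> \<noteq> 0\<close> by (intro continuous_on_subset[OF cont]) auto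
  qed (use inside \<open>\<zeta> \<noteq> 0\<close> in \<open>auto simp: less_imp_le\<close>)
  hence nw: "norm (w \<zeta>) = 1" using w\<zeta> by simp

  define G T W where "G = g \<zeta>" and "T = \<zeta> * g' \<zeta>" and "W = w \<zeta>"
  have "((\<lambda>z. 2 * g z * (z * g' z)) has_field_derivative 2 * g' \<zeta> * T + 2 * G * t' \<zeta>) (at \<zeta>)"
    using DERIV_mult[OF DERIV_cmult[OF g[OF \<zeta>1], of 2] t[OF \<zeta>1]]
    by (simp add: G_def T_def mult_ac)
  hence w2: "((\<lambda>z. z * (2 * g z * g' z)) has_field_derivative 2 * g' \<zeta> * T + 2 * G * t' \<zeta>) (at \<zeta>)"
    by (simp add: mult_ac)
  have "w \<zeta> \<noteq> 0" "\<And>u. norm u < norm \<zeta> \<Longrightarrow> norm (w u) < norm (w \<zeta>)"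
    using nw inside by auto
  from Jack_Miller_Mocanu[OF w w2 w0 \<zeta>1 this(2,1)]
  obtain m where m: "m \<ge> 1" "\<zeta> * (2 * G * g' \<zeta>) = of_real m * W"
      "m\<^sup>2 \<le> Re (\<zeta> * (2 * g' \<zeta> * T + 2 * G * t' \<zeta>) / W)"
    unfolding G_def W_def by blast
  have W0: "W \<noteq> 0" using nw W_def by auto
  have GT: "2 * G * T = of_real m * W" using m(2) by (simp add: T_def mult_ac)
  hence G0: "G \<noteq> 0" using W0 m(1) by auto
  have WG: "1 + W = G\<^sup>2" by (simp add: W_def G_def w_def)
  define B where "B = A * (G - 1) + \<zeta> * G / 4"
  have "\<zeta> * t' \<zeta> + (a * T + B) = 0"
    using ode[OF \<zeta>1] by (simp add: B_def G_def T_def add_ac)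
  hence X: "\<zeta> * t' \<zeta> = - (a * T + B)"
    by (simp only: eq_neg_iff_add_eq_0)
  have T: "T = of_real m * W / (2 * G)" using GT G0 by (simp add: field_simps)
  have "\<zeta> * (2 * g' \<zeta> * T + 2 * G * t' \<zeta>) / W = (2 * T\<^sup>2 + 2 * G * (\<zeta> * t' \<zeta>)) / W"
    by (simp add: T_def power2_eq_square algebra_simps)
  \<comment> \<open>Substituting \<open>T\<close> turns 2 T^2 / W into (m^2 / 2) W / G^2, and G^2 =
    1 + W. Its real part is m^2 / 4, which leaves the factor 3/4 = 1 - 1/4 below.\<close>
  also have "\<dots> = of_real (m\<^sup>2 / 2) * (W / (1 + W)) - of_real m * a - 2 * G * B / W"
    unfolding X WG T using W0 G0 by (simp add: field_simps power2_eq_square)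
  finally have "m\<^sup>2 \<le> Re (of_real (m\<^sup>2 / 2) * (W / (1 + W)) - of_real m * a - 2 * G * B / W)"
    using m(3) by simp
  also have "\<dots> = m\<^sup>2 / 2 * Re (W / (1 + W)) - m * Re a - Re (2 * G * B / W)"
    by (simp only: minus_complex.sel Re_complex_of_real Im_complex_of_real times_complex.sel)
  also have "Re (W / (1 + W)) = 1 / 2"
    using nw G0 WG by (intro Re_div_one_plus) (auto simp: W_def)
  finally have 1: "3 / 4 * m\<^sup>2 + m * Re a \<le> - Re (2 * G * B / W)"
    by simp
  have "(norm G)\<^sup>2 \<le> 2"
    using norm_triangle_ineq[of 1 W] nw by (simp add: W_def flip: norm_power WG[unfolded W_def])
  \<comment> \<open>The rational bound 3/2 for sqrt 2 gives 2 |G|^2 + 2 |G| \<le> 4 + 3 = 7.\<close>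
  hence nG: "norm G \<le> 3 / 2" "norm G * norm G \<le> 2"
    using power2_le_imp_le[of "norm G" "3/2"] by (auto simp: power2_eq_square)
  have "- Re (2 * G * B / W) \<le> norm (2 * G * B / W)"
    using abs_Re_le_cmod[of "2 * G * B / W"] by simp
  also have "\<dots> = 2 * norm G * norm B"
    using nw by (simp add: norm_mult norm_divide W_def)
  also have "\<dots> \<le> 2 * norm G * (norm A * (norm G + 1) + norm G / 4)"
  proof (rule mult_left_mono)
    have "norm B \<le> norm A * norm (G - 1) + norm \<zeta> * norm G / 4"
      unfolding B_def using norm_triangle_ineq[of "A * (G - 1)" "\<zeta> * G / 4"]
      by (simp add: norm_mult norm_divide)
    also have "\<dots> \<le> norm A * (norm G + 1) + 1 * norm G / 4"
      using \<zeta>1 norm_triangle_ineq4[of G 1]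
      by (intro add_mono mult_left_mono divide_right_mono mult_right_mono) auto
    finally show "norm B \<le> norm A * (norm G + 1) + norm G / 4" by simp
  qed simp
  also have "\<dots> = norm A * (2 * (norm G * norm G) + 2 * norm G) + norm G * norm G / 2"
    by (simp add: algebra_simps)
  also have "\<dots> \<le> norm A * 7 + 2 / 2"
    using nG by (intro add_mono mult_left_mono divide_right_mono) auto
  finally have 2: "3 / 4 * m\<^sup>2 + m * Re a \<le> 7 * norm A + 1"
    using 1 by simp
  \<comment> \<open>Positivity of \<open>Re a\<close> allows m to be replaced by 1: then 3/4 + Re a
    \<le> 7 |A| + 1, which contradicts \<open>bound\<close>.\<close>
  have "Re a > 0" using bound norm_ge_zero[of A] by linarith
  hence "1 * Re a \<le> m * Re a" using m(1) by (intro mult_right_mono) auto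
  moreover have "1 \<le> m\<^sup>2" using m(1) by simp
  ultimately show False using 2 bound by linarith
qed

text \<open>If Re g = 0, then g^2 is real and nonpositive, so |g^2 - 1| \<ge> 1. Connectedness of
  the disc therefore carries Re g > 0 from the origin to \<open>z\<close>.\<close>

lemma csqrt_power2_of_lemniscate:
  fixes g :: "complex \<Rightarrow> complex"
  assumes cont: "continuous_on (ball 0 1) g" and g0: "g 0 = 1"
    and less: "\<And>z. norm z < 1 \<Longrightarrow> norm ((g z)\<^sup>2 - 1) < 1"
    and z: "norm z < 1"
  shows "csqrt ((g z)\<^sup>2) = g z"
proof -
  have nz: "Re (g u) \<noteq> 0" if "norm u < 1" for u
  proof
    assume "Re (g u) = 0"
    hence "Re ((g u)\<^sup>2 - 1) = - ((Im (g u))\<^sup>2) - 1" by (simp add: power2_eq_square)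
    hence "Re ((g u)\<^sup>2 - 1) \<le> -1" by simp
    with abs_Re_le_cmod[of "(g u)\<^sup>2 - 1"] less[OF that] show False by linarith
  qed
  have "connected ((\<lambda>u. Re (g u)) ` ball 0 1)"
    by (intro connected_continuous_image continuous_intros cont) auto
  moreover have "1 \<in> (\<lambda>u. Re (g u)) ` ball 0 1"
    using g0 by (intro image_eqI[of _ _ 0]) auto
  moreover have "0 \<notin> (\<lambda>u. Re (g u)) ` ball 0 1"
    using nz by (metis imageE mem_ball_0)
  ultimately have "Re (g z) > 0"
    using connectedD_interval[of "(\<lambda>u. Re (g u)) ` ball 0 1" "Re (g z)" 1 0] z
    by (meson image_eqI mem_ball_0 not_less zero_le_one)
  thus ?thesis by (simp add: csqrt_square)
qed

section \<open>The Lommel power series and its differential equation\<close>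

lemma euler_operator_powser:
  fixes c :: "nat \<Rightarrow> complex"
  assumes "\<And>z. summable (\<lambda>n. c n * z ^ n)"
  shows "(\<lambda>n. of_nat n * c n * z ^ n) sums (z * (\<Sum>n. diffs c n * z ^ n))"
proof -
  \<comment> \<open>At n = 0 the truncated exponent would be off by one, but the factor
    \<open>of_nat n\<close> vanishes.\<close>
  have eq: "z * (of_nat n * c n * z ^ (n - Suc 0)) = of_nat n * c n * z ^ n" for n
    by (cases n) (auto simp: algebra_simps)
  have "(\<lambda>n. of_nat n * c n * z ^ (n - Suc 0)) sums (\<Sum>n. diffs c n * z ^ n)"
    by (intro diffs_equiv termdiff_converges_all assms)
  from sums_mult[OF this, of z] show ?thesis
    by (simp only: eq)
qed

definition lommel_coeff :: "complex \<Rightarrow> complex \<Rightarrow> nat \<Rightarrow> complex" where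
  "lommel_coeff K F n = (-1/4) ^ n / (pochhammer K n * pochhammer F n)"

lemma lommel_coeff_0 [simp]: "lommel_coeff K F 0 = 1"
  by (simp add: lommel_coeff_def)

lemma lommel_coeff_Suc:
  "lommel_coeff K F (Suc n) = lommel_coeff K F n * (-1/4) / ((K + of_nat n) * (F + of_nat n))"
  by (simp add: lommel_coeff_def pochhammer_Suc mult_ac)

lemma summable_lommel_coeff: "summable (\<lambda>n. lommel_coeff K F n * z ^ n)"
proof (rule summable_ratio_test)
  \<comment> \<open>Beyond \<open>N\<close>, |K + n| \<ge> |z| + 1 and |F + n| \<ge> 1, so the ratio
    of consecutive terms is at most 1/4.\<close>
  define N where "N = nat \<lceil>norm K + norm F + norm z + 1\<rceil>"
  fix n assume "n \<ge> N"
  hence n: "real n \<ge> norm K + norm F + norm z + 1" unfolding N_def by (simp only: nat_ceiling_le_eq)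
  have d: "real n - norm x \<le> norm (x + of_nat n)" for x :: complex
    using norm_diff_ineq[of "of_nat n" x] by (simp add: add.commute)
  have "norm (K + of_nat n) \<ge> norm z + 1"
    using d[of K] n norm_ge_zero[of F] by linarith
  moreover have "norm (F + of_nat n) \<ge> 1"
    using d[of F] n norm_ge_zero[of K] norm_ge_zero[of z] by linarith
  ultimately have "(norm z + 1) * 1 \<le> norm (K + of_nat n) * norm (F + of_nat n)"
    by (intro mult_mono) auto
  hence "norm z + 1 \<le> norm ((K + of_nat n) * (F + of_nat n))"
    by (simp add: norm_mult)
  hence le: "norm z \<le> norm ((K + of_nat n) * (F + of_nat n))" "0 < norm ((K + of_nat n) * (F + of_nat n))"
    using norm_ge_zero[of z] by linarith+
  have "norm (lommel_coeff K F (Suc n) * z ^ Suc n) =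
      norm (lommel_coeff K F n * z ^ n) * (norm z / norm ((K + of_nat n) * (F + of_nat n))) / 4"
    unfolding lommel_coeff_Suc power_Suc norm_mult norm_divide by (simp add: mult_ac)
  also have "\<dots> \<le> norm (lommel_coeff K F n * z ^ n) * 1 / 4"
    using le by (intro divide_right_mono mult_left_mono) (auto simp: divide_le_eq_1)
  finally show "norm (lommel_coeff K F (Suc n) * z ^ Suc n) \<le> 1 / 4 * norm (lommel_coeff K F n * z ^ n)"
    by simp
qed simp

text \<open>The entire extension of h(z)/z across the origin, where the HOL quotient would be
  0.\<close>

definition lommel_g :: "complex \<Rightarrow> complex \<Rightarrow> complex \<Rightarrow> complex" where
  "lommel_g K F z = (\<Sum>n. lommel_coeff K F n * z ^ n)"

lemma lommel_g_0 [simp]: "lommel_g K F 0 = 1"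
  by (simp add: lommel_g_def)

lemma lommel_h_eq: "lommel_h \<mu> p z = z * lommel_g ((\<mu> - p + 3) / 2) ((\<mu> + p + 3) / 2) z"
proof -
  let ?c = "lommel_coeff ((\<mu> - p + 3) / 2) ((\<mu> + p + 3) / 2)"
  have "summable (\<lambda>n. ?c (Suc n) * z ^ Suc n)"
    using summable_lommel_coeff by (subst summable_Suc_iff)
  from suminf_mult[OF this, of z]
  have "lommel_h \<mu> p z = z + z * (\<Sum>n. ?c (Suc n) * z ^ Suc n)"
    by (simp add: lommel_h_def lommel_coeff_def mult_ac)
  also have "(\<Sum>n. ?c (Suc n) * z ^ Suc n) = (\<Sum>n. ?c n * z ^ n) - 1"
    by (subst suminf_split_head[OF summable_lommel_coeff]) simp
  finally show ?thesis
    by (simp add: lommel_g_def algebra_simps)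
qed

text \<open>The differential equation has a = K + F - 2 and A = (K - 1)(F - 1). On z^n its Euler
  part acts as n^2 + a n + A = (n + K - 1)(n + F - 1), which cancels the denominator in the
  coefficient recursion. The 9/4 in \<open>bound\<close> is 2 + 1/4.\<close>

lemma lommel_g_lemniscate:
  fixes K F :: complex
  assumes KF: "\<And>n. K + of_nat n \<noteq> 0" "\<And>n. F + of_nat n \<noteq> 0"
    and bound: "7 * norm ((K - 1) * (F - 1)) < Re (K + F) - 9 / 4"
    and z: "norm z < 1"
  shows "norm ((lommel_g K F z)\<^sup>2 - 1) < 1"
proof -
  let ?c = "lommel_coeff K F"
  define b where "b = (\<lambda>n. of_nat n * ?c n)"
  define g' where "g' = (\<lambda>z. \<Sum>n. diffs ?c n * z ^ n)"
  define t' where "t' = (\<lambda>z. \<Sum>n. diffs b n * z ^ n)"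
  have sumsg: "(\<lambda>n. ?c n * z ^ n) sums lommel_g K F z" for z
    unfolding lommel_g_def by (rule summable_sums[OF summable_lommel_coeff])
  have sums1: "(\<lambda>n. b n * z ^ n) sums (z * g' z)" for z
    unfolding b_def g'_def by (rule euler_operator_powser[OF summable_lommel_coeff])
  hence sumb: "summable (\<lambda>n. b n * z ^ n)" for z by (auto simp: sums_iff)
  have sums2: "(\<lambda>n. of_nat n * b n * z ^ n) sums (z * t' z)" for z
    unfolding t'_def by (rule euler_operator_powser[OF sumb])
  have g: "(lommel_g K F has_field_derivative g' z) (at z)" for z
    unfolding lommel_g_def[abs_def] g'_def
    by (rule termdiffs_strong_converges_everywhere[OF summable_lommel_coeff])
  have "(\<lambda>z. z * g' z) = (\<lambda>z. \<Sum>n. b n * z ^ n)"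
    using sums1 by (auto simp: sums_iff)
  hence t: "((\<lambda>z. z * g' z) has_field_derivative t' z) (at z)" for z
    unfolding t'_def by (simp only: termdiffs_strong_converges_everywhere[OF sumb])
  have ode: "z * t' z + (K + F - 2) * (z * g' z) + (K - 1) * (F - 1) * (lommel_g K F z - 1)
      + z * lommel_g K F z / 4 = 0" for z
  proof -
    \<comment> \<open>The term \<open>f 0\<close> is A, the constant that turns A g into A (g -
      1).\<close>
    define f where "f = (\<lambda>n. of_nat n * b n * z ^ n + (K + F - 2) * (b n * z ^ n)
      + (K - 1) * (F - 1) * (?c n * z ^ n))"
    have "f sums (z * t' z + (K + F - 2) * (z * g' z) + (K - 1) * (F - 1) * lommel_g K F z)"
      unfolding f_def by (intro sums_add sums_mult sums1 sums2 sumsg)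
    moreover have "f (Suc n) = - (z / 4) * (?c n * z ^ n)" for n
    proof -
      have "f (Suc n) = (K + of_nat n) * (F + of_nat n) * ?c (Suc n) * z ^ Suc n"
        unfolding f_def b_def by (simp add: algebra_simps)
      also have "(K + of_nat n) * (F + of_nat n) * ?c (Suc n) = - ?c n / 4"
        unfolding lommel_coeff_Suc using KF[of n] by simp
      finally show ?thesis by simp
    qed
    hence "(\<lambda>n. f (Suc n)) sums (- (z / 4) * lommel_g K F z)"
      by (simp only: sums_mult[OF sumsg])
    hence "f sums (- (z / 4) * lommel_g K F z + f 0)"
      by (rule sums_Suc)
    moreover have "f 0 = (K - 1) * (F - 1)" by (simp add: f_def b_def)
    ultimately show ?thesis
      by (auto dest: sums_unique2 simp: algebra_simps)
  qed
  show ?thesis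
    using lemniscate_bound_of_ode[OF g t ode] bound z by simp
qed

section \<open>Subordination for the integral of h(t)/t\<close>

theorem theorem2p9:
  fixes \<mu> p :: complex
  assumes "\<nexists>k::int. odd k \<and> k < 0 \<and> \<mu> + p = of_int k"
    and "\<nexists>k::int. odd k \<and> k < 0 \<and> \<mu> - p = of_int k"
    and "Re \<mu> > -1"
    and "norm (((\<mu> + 1)\<^sup>2 - p\<^sup>2) / 2) * sqrt 3 < Re \<mu> / (2 * sqrt 2) + 3 / (8 * sqrt 2)"
  shows "lommel_f \<mu> p holomorphic_on ball 0 1 \<and>
         (\<forall>z\<in>ball 0 1 - {0}. deriv (lommel_f \<mu> p) z = lommel_h \<mu> p z / z) \<and>
         deriv (lommel_f \<mu> p) \<prec>\<^sub>D (\<lambda>z. csqrt (1 + z))"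
proof -
  define K F where "K = (\<mu> - p + 3) / 2" and "F = (\<mu> + p + 3) / 2"
  define g where "g = lommel_g K F"
  have nonzero: "(\<nu> + 3) / 2 + of_nat n \<noteq> 0"
    if "\<nexists>k::int. odd k \<and> k < 0 \<and> \<nu> = of_int k" for \<nu> :: complex and n
  proof
    assume "(\<nu> + 3) / 2 + of_nat n = 0"
    hence "\<nu> = of_int (- (2 * int n + 3))"
      by (simp add: field_simps eq_neg_iff_add_eq_0)
    moreover have "odd (- (2 * int n + 3))" "- (2 * int n + 3) < 0" by auto
    ultimately show False using that by blast
  qed
  have KF: "K + of_nat n \<noteq> 0" "F + of_nat n \<noteq> 0" for n
    unfolding K_def F_def using nonzero assms(1,2) by blast+
  have A: "(K - 1) * (F - 1) = (((\<mu> + 1)\<^sup>2 - p\<^sup>2) / 2) / 2"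
    by (simp add: K_def F_def field_simps power2_eq_square)
  define N where "N = norm (((\<mu> + 1)\<^sup>2 - p\<^sup>2) / 2)"
  \<comment> \<open>The hypothesis times 2 sqrt 2 reads 2 sqrt 6 N < Re \<mu> + 3/4. As 2 sqrt 6
    exceeds 7/2 and |A| = N / 2, the bound with constant 7 follows.\<close>
  have "N * sqrt 3 * sqrt 2 * 2 < Re \<mu> + 3 / 4"
    using assms(4) by (fold N_def) (simp add: field_simps)
  moreover have "7 / 2 * N \<le> 2 * (sqrt 3 * sqrt 2) * N"
  proof (rule mult_right_mono)
    have "7 / 4 \<le> sqrt 6" by (rule real_le_rsqrt) (simp add: power2_eq_square)
    thus "7 / 2 \<le> 2 * (sqrt 3 * sqrt 2)" by (simp flip: real_sqrt_mult)
  qed (simp add: N_def)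
  ultimately have "7 / 2 * N < Re \<mu> + 3 / 4" by (simp add: mult_ac)
  moreover have "norm ((K - 1) * (F - 1)) = N / 2"
    unfolding A N_def by (subst norm_divide) simp
  moreover have "Re (K + F) = Re \<mu> + 3"
    by (simp add: K_def F_def field_simps)
  ultimately have bound: "7 * norm ((K - 1) * (F - 1)) < Re (K + F) - 9 / 4"
    by simp
  have less: "norm ((g z)\<^sup>2 - 1) < 1" if "norm z < 1" for z
    unfolding g_def using KF bound that by (rule lommel_g_lemniscate)
  have holg: "g holomorphic_on UNIV"
    unfolding g_def lommel_g_def[abs_def] holomorphic_on_def field_differentiable_def
    using termdiffs_strong_converges_everywhere[OF summable_lommel_coeff] by fastforce
  have h: "lommel_h \<mu> p z = z * g z" for z
    by (simp add: lommel_h_eq g_def K_def F_def)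
  have g0: "g 0 = 1" by (simp add: g_def)
  obtain P where P: "\<And>z. (P has_field_derivative g z) (at z)"
    using holomorphic_convex_primitive'[OF _ _ holg] by auto
  have f: "lommel_f \<mu> p z = P z - P 0" for z
  proof -
    have "(g has_contour_integral (P z - P 0)) (linepath 0 z)"
      using contour_integral_primitive[of UNIV P g "linepath 0 z"] P by simp
    hence "((\<lambda>x. g (linepath 0 z x) * (z - 0)) has_integral (P z - P 0)) {0..1}"
      by (simp only: has_contour_integral_linepath)
    \<comment> \<open>For \<open>z \<noteq> 0\<close> the integrands can differ only at x = 0, where
      0 / 0 = 0; for \<open>z = 0\<close> the factor \<open>z - 0\<close> makes both vanish.\<close>
    hence "((\<lambda>x. lommel_h \<mu> p (linepath 0 z x) / linepath 0 z x * (z - 0))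
        has_integral (P z - P 0)) {0..1}"
      by (rule has_integral_spike_finite[of "{0}", rotated 2])
        (cases "z = 0"; auto simp: h linepath_def scaleR_conv_of_real)+
    thus ?thesis
      unfolding lommel_f_def
      by (intro contour_integral_unique) (simp only: has_contour_integral_linepath)
  qed
  have f': "(lommel_f \<mu> p has_field_derivative g z) (at z)" for z
    unfolding f[abs_def] using P by (auto intro!: derivative_eq_intros)
  have deriv: "deriv (lommel_f \<mu> p) = g"
    using f' by (auto intro: DERIV_imp_deriv)
  have "lommel_f \<mu> p holomorphic_on ball 0 1"
    using f' by (auto simp: holomorphic_on_open)
  moreover have "g \<prec>\<^sub>D (\<lambda>z. csqrt (1 + z))"
    unfolding subordinate_def
  proof (intro conjI exI[of _ "\<lambda>z. (g z)\<^sup>2 - 1"] ballI)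
    show holb: "g holomorphic_on ball 0 1"
      using holg by (rule holomorphic_on_subset) simp
    show "(\<lambda>z. (g z)\<^sup>2 - 1) holomorphic_on ball 0 1"
      by (intro holomorphic_intros holb)
    show "(\<lambda>z. csqrt (1 + z)) holomorphic_on ball 0 1"
    proof (rule holomorphic_on_compose_gen[of "\<lambda>z. 1 + z" _ csqrt "- \<real>\<^sub>\<le>\<^sub>0", unfolded o_def])
      show "(+) 1 ` (ball 0 1 :: complex set) \<subseteq> - \<real>\<^sub>\<le>\<^sub>0"
      proof safe
        fix z :: complex assume "z \<in> ball 0 1" "1 + z \<in> \<real>\<^sub>\<le>\<^sub>0"
        thus False using abs_Re_le_cmod[of z] by (auto simp: complex_nonpos_Reals_iff)
      qed
    qed (auto intro!: holomorphic_intros)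
    show "g z = csqrt (1 + ((g z)\<^sup>2 - 1))" if "z \<in> ball 0 1" for z
      using csqrt_power2_of_lemniscate[OF holomorphic_on_imp_continuous_on[OF holb] g0 less] that
      by simp
  qed (use less g0 in auto)
  ultimately show ?thesis
    by (simp add: deriv h)
qed

end
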